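(* For each pair $M<N$ in $\mathbb{N}_0$ there exists a surjective algebra map $\pi_{M,N}:\mathcal{D}_{\lambda,N}(\mathfrak{sl}_2)\to\mathcal{D}_{\lambda,M}(\mathfrak{sl}_2)$ such that, for $0\le i\le N$, $\pi_{M,N}(X^{[i]})=X^{[i-N+M]}$ for $X\in\{E,F,K\}$ if $i\ge N-M$, and $\pi_{M,N}(E^{[i]})=\pi_{M,N}(F^{[i]})=0$, $\pi_{M,N}(K^{[i]})=1$ if $i<N-M$. In particular, there exists a surjective algebra map $\pi_N:\mathcal{D}_{\lambda,N}(\mathfrak{sl}_2)\to\mathfrak{u}_\lambda(\mathfrak{sl}_2)$ with $$\pi_N(E^{[i]})=\delta_{iN}E,\qquad\pi_N(F^{[i]})=\delta_{iN}F,\qquad\pi_N(K^{[i]})=K^{\delta_{iN}},\qquad 0\le i\le N.$$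
   Context: The base field is $\mathbb{C}$; $\ell>1$ is an odd integer and $\lambda\in\mathbb{C}$ is a primitive root of unity of order $\ell$. Put $[m]_\lambda=\frac{\lambda^m-\lambda^{-m}}{\lambda-\lambda^{-1}}$, $[m]_\lambda^!=\prod_{k=1}^m[k]_\lambda$. For an invertible element $X$ of a $\mathbb{C}$-algebra, $s\in\mathbb{Z}$ and $0\le a<\ell$, put $\begin{bmatrix}X;s\\ a\end{bmatrix}_\lambda=\prod_{j=1}^a\frac{\lambda^{s-j+1}X-\lambda^{-s+j-1}X^{-1}}{\lambda^j-\lambda^{-j}}$. $\mathfrak{u}_\lambda(\mathfrak{sl}_2)$ is the algebra generated by $E,K,F$ with relations $K^\ell=1$, $KF=\lambda^{-2}FK$, $KE=\lambda^2EK$, $E^\ell=F^\ell=0$, $EF-FE=\frac{K-K^{-1}}{\lambda-\lambda^{-1}}$. For $N\in\mathbb{N}_0$, $\mathcal{D}_{\lambda,N}(\mathfrak{sl}_2)$ is the $\mathbb{C}$-algebra with generators $E^{[i]},F^{[i]},K^{[i]}$, $0\le i\le N$, and relations (for all $0\le i,j\le N$): $K^{[i]}K^{[j]}=K^{[j]}K^{[i]}$; $(K^{[i]})^\ell=1$; $K^{[i]}E^{[j]}=\lambda^{2\delta_{ij}}E^{[j]}K^{[i]}$; $K^{[i]}F^{[j]}=\lambda^{-2\delta_{ij}}F^{[j]}K^{[i]}$; $E^{[i]}E^{[j]}=E^{[j]}E^{[i]}$; $F^{[i]}F^{[j]}=F^{[j]}F^{[i]}$; $(E^{[i]})^\ell=(F^{[i]})^\ell=0$;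 $E^{[i]}F^{[j]}=F^{[j]}E^{[i]}$ for $j\ne i$; and $$E^{[j]}F^{[j]}=\sum_{t=0}^{\ell^j}F^{(\ell^j-t)}\begin{Bmatrix}K;2t-2\ell^j\\ t\end{Bmatrix}E^{(\ell^j-t)}.$$ Here, for $m=\sum_{i=0}^Nm_i\ell^i$ and $t=\sum_{i=0}^N t_i\ell^i$ with $0\le m_i,t_i<\ell$, $E^{(m)}=\prod_{i=0}^N\frac{(E^{[i]})^{m_i}}{[m_i]_\lambda^!}$, $F^{(m)}=\prod_{i=0}^N\frac{(F^{[i]})^{m_i}}{[m_i]_\lambda^!}$, and $\begin{Bmatrix}K;s\\ t\end{Bmatrix}=\prod_{i=0}^N\begin{bmatrix}K^{[i]};s_i\\ t_i\end{bmatrix}_\lambda$, where $s_0,\dots,s_N\in\{0,\dots,\ell-1\}$ are the base-$\ell$ digits of $s$ reduced modulo $\ell^{N+1}$. *)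

theory Defs
  imports Complex_Main "HOL-Library.Poly_Mapping" "HOL-Algebra.QuotRing" "HOL-Algebra.Module"
begin

section \<open>Associative unital algebras over the complex numbers\<close>

text \<open>
  A complex algebra is represented by a record of type \<open>(complex, 'a) module\<close>, i.e. a ring
  record together with a scalar multiplication. The locale \<open>algebra\<close> of
  \<open>HOL-Algebra\<close> cannot be used, since it requires the ring to be commutative.
\<close>

definition complex_algebra :: "(complex, 'a, 'm) module_scheme \<Rightarrow> bool" where
  "complex_algebra A \<longleftrightarrow> ring A \<and>
     (\<forall>c. \<forall>x\<in>carrier A. c \<odot>\<^bsub>A\<^esub> x \<in> carrier A) \<and>
     (\<forall>c d. \<forall>x\<in>carrier A. (c + d) \<odot>\<^bsub>A\<^esub> x = (c \<odot>\<^bsub>A\<^esub> x) \<oplus>\<^bsub>A\<^esub> (d \<odot>\<^bsub>A\<^esub> x)) \<and>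
     (\<forall>c. \<forall>x\<in>carrier A. \<forall>y\<in>carrier A. c \<odot>\<^bsub>A\<^esub> (x \<oplus>\<^bsub>A\<^esub> y) = (c \<odot>\<^bsub>A\<^esub> x) \<oplus>\<^bsub>A\<^esub> (c \<odot>\<^bsub>A\<^esub> y)) \<and>
     (\<forall>c d. \<forall>x\<in>carrier A. (c * d) \<odot>\<^bsub>A\<^esub> x = c \<odot>\<^bsub>A\<^esub> (d \<odot>\<^bsub>A\<^esub> x)) \<and>
     (\<forall>x\<in>carrier A. 1 \<odot>\<^bsub>A\<^esub> x = x) \<and>
     (\<forall>c. \<forall>x\<in>carrier A. \<forall>y\<in>carrier A. (c \<odot>\<^bsub>A\<^esub> x) \<otimes>\<^bsub>A\<^esub> y = c \<odot>\<^bsub>A\<^esub> (x \<otimes>\<^bsub>A\<^esub> y)) \<and>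
     (\<forall>c. \<forall>x\<in>carrier A. \<forall>y\<in>carrier A. x \<otimes>\<^bsub>A\<^esub> (c \<odot>\<^bsub>A\<^esub> y) = c \<odot>\<^bsub>A\<^esub> (x \<otimes>\<^bsub>A\<^esub> y))"

definition alg_hom ::
  "(complex, 'a, 'm) module_scheme \<Rightarrow> (complex, 'b, 'n) module_scheme \<Rightarrow> ('a \<Rightarrow> 'b) set" where
  "alg_hom A B = {h \<in> ring_hom A B. \<forall>c. \<forall>x\<in>carrier A. h (c \<odot>\<^bsub>A\<^esub> x) = c \<odot>\<^bsub>B\<^esub> h x}"

definition alg_surj_hom ::
  "(complex, 'a, 'm) module_scheme \<Rightarrow> (complex, 'b, 'n) module_scheme \<Rightarrow> ('a \<Rightarrow> 'b) set" where
  "alg_surj_hom A B = {h \<in> alg_hom A B. h ` carrier A = carrier B}"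


section \<open>Free algebras and presentations\<close>

text \<open>
  Words form the free monoid, written additively because the convolution product on
  \<open>'a \<Rightarrow>\<^sub>0 complex\<close> is the monoid algebra of an additive monoid. A separate type
  of words is used in order not to put a global \<open>monoid_add\<close> instance on lists.
\<close>

datatype 'g fword = Fword (letters: "'g list")

instantiation fword :: (type) monoid_add
begin

definition zero_fword :: "'g fword" where
  "zero_fword = Fword []"

definition plus_fword :: "'g fword \<Rightarrow> 'g fword \<Rightarrow> 'g fword" where
  "plus_fword u v = Fword (letters u @ letters v)"

instance
  by intro_classes (simp_all add: zero_fword_def plus_fword_def)

end

type_synonym 'g falg = "'g fword \<Rightarrow>\<^sub>0 complex"

definition scal :: "complex \<Rightarrow> 'g falg" where
  "scal c = Poly_Mapping.single 0 c"

definition gen :: "'g \<Rightarrow> 'g falg" where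
  "gen g = Poly_Mapping.single (Fword [g]) 1"

text \<open>The free algebra on a set \<open>G\<close> of letters, which need not exhaust its type.\<close>

definition free_algebra :: "'g set \<Rightarrow> (complex, 'g falg) module" where
  "free_algebra G =
     \<lparr> carrier = {p. \<forall>w \<in> Poly_Mapping.keys p. set (letters w) \<subseteq> G},
       mult = (*), one = 1, zero = 0, add = (+), smult = (\<lambda>c p. scal c * p) \<rparr>"

lemma free_algebra_simps [simp]:
  "mult (free_algebra G) = (*)" "one (free_algebra G) = 1"
  "zero (free_algebra G) = 0" "add (free_algebra G) = (+)"
  "smult (free_algebra G) = (\<lambda>c p. scal c * p)"
  by (simp_all add: free_algebra_def)

lemma free_algebra_closed [simp]:
  "0 \<in> carrier (free_algebra G)" "1 \<in> carrier (free_algebra G)"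
  "scal c \<in> carrier (free_algebra G)"
  "g \<in> G \<Longrightarrow> gen g \<in> carrier (free_algebra G)"
  by (auto simp: free_algebra_def scal_def gen_def zero_fword_def simp flip: single_one)

lemma free_algebra_add_closed [simp]:
  "p \<in> carrier (free_algebra G) \<Longrightarrow> q \<in> carrier (free_algebra G) \<Longrightarrow> p + q \<in> carrier (free_algebra G)"
  unfolding free_algebra_def using Poly_Mapping.keys_add[of p q] by fastforce

lemma free_algebra_minus_closed [simp]:
  "p \<in> carrier (free_algebra G) \<Longrightarrow> q \<in> carrier (free_algebra G) \<Longrightarrow> p - q \<in> carrier (free_algebra G)"
  unfolding free_algebra_def using Poly_Mapping.keys_diff[of p q] by fastforce

lemma free_algebra_mult_closed [simp]:
  "p \<in> carrier (free_algebra G) \<Longrightarrow> q \<in> carrier (free_algebra G) \<Longrightarrow> p * q \<in> carrier (free_algebra G)"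
  unfolding free_algebra_def using Poly_Mapping.keys_mult[of p q]
  by (fastforce simp: plus_fword_def)

lemma free_algebra_power_closed [simp]:
  "p \<in> carrier (free_algebra G) \<Longrightarrow> p ^ n \<in> carrier (free_algebra G)"
  by (induction n) auto

lemma free_algebra_prod_list_closed [simp]:
  "(\<And>x. x \<in> set xs \<Longrightarrow> f x \<in> carrier (free_algebra G)) \<Longrightarrow>
     prod_list (map f xs) \<in> carrier (free_algebra G)"
  by (induction xs) auto

lemma free_algebra_sum_closed [simp]:
  "(\<And>x. x \<in> A \<Longrightarrow> f x \<in> carrier (free_algebra G)) \<Longrightarrow> sum f A \<in> carrier (free_algebra G)"
  by (induction A rule: infinite_finite_induct) auto

lemma scal_add: "scal (c + d) = scal c + scal d"
  by (simp add: scal_def single_add)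

lemma scal_mult: "scal (c * d) = scal c * scal d"
  by (simp add: scal_def mult_single)

lemma scal_1: "scal 1 = 1"
  by (simp add: scal_def)

lemma scal_commute: "p * scal c = scal c * (p :: 'g falg)"
proof (induction p rule: update_induct)
  case const
  show ?case by simp
next
  case (update f a b)
  have "Poly_Mapping.update a b f = Poly_Mapping.single a b + f"
    using update(1)
    by (intro poly_mapping_eqI)
       (auto simp: lookup_update lookup_add lookup_single when_def in_keys_iff)
  moreover have "Poly_Mapping.single a b * scal c = scal c * Poly_Mapping.single a b"
    by (simp add: scal_def mult_single mult.commute)
  ultimately show ?case using update(3) by (simp add: algebra_simps)
qed

lemma ring_free_algebra: "ring (free_algebra G)"
proof (rule ringI)
  show "abelian_group (free_algebra G)"
  proof (rule abelian_groupI)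
    fix x assume "x \<in> carrier (free_algebra G)"
    then show "\<exists>y\<in>carrier (free_algebra G). y \<oplus>\<^bsub>free_algebra G\<^esub> x = \<zero>\<^bsub>free_algebra G\<^esub>"
      by (intro bexI[of _ "0 - x"]) (simp, intro free_algebra_minus_closed, auto)
  qed (auto simp: add_ac)
  show "Group.monoid (free_algebra G)"
    by (rule monoidI) (auto simp: mult.assoc)
qed (auto simp: algebra_simps)

lemma complex_algebra_free_algebra: "complex_algebra (free_algebra G)"
proof -
  have "p * (scal c * q) = scal c * (p * q)" for c and p q :: "'a falg"
    by (simp add: scal_commute[of p] flip: mult.assoc)
  note comm = this
  show ?thesis
    unfolding complex_algebra_def
    by (intro conjI ballI allI ring_free_algebra)
       (simp_all add: scal_add scal_mult scal_1 distrib_left distrib_right mult.assoc, rule comm)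
qed

text \<open>
  The quotient by a (two-sided) ideal; the scalar multiplication is lifted to cosets in the
  same way as \<^const>\<open>rcoset_mult\<close> lifts the product.
\<close>

definition quot_algebra :: "(complex, 'a) module \<Rightarrow> 'a set \<Rightarrow> (complex, 'a set) module" where
  "quot_algebra A I =
     ring.extend (A Quot I) \<lparr> smult = (\<lambda>c X. \<Union>x\<in>X. I +>\<^bsub>A\<^esub> (c \<odot>\<^bsub>A\<^esub> x)) \<rparr>"

text \<open>
  The algebra with generating set \<open>G\<close> and relations \<open>r = 0\<close> for \<open>r \<in> S\<close>,
  and the image in it of an element of the free algebra.
\<close>

definition presented :: "'g set \<Rightarrow> 'g falg set \<Rightarrow> (complex, 'g falg set) module" where
  "presented G S = quot_algebra (free_algebra G) (Idl\<^bsub>free_algebra G\<^esub> S)"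

definition presented_cls :: "'g set \<Rightarrow> 'g falg set \<Rightarrow> 'g falg \<Rightarrow> 'g falg set" where
  "presented_cls G S p = (Idl\<^bsub>free_algebra G\<^esub> S) +>\<^bsub>free_algebra G\<^esub> p"

lemma quot_algebra_simps [simp]:
  "carrier (quot_algebra A I) = carrier (A Quot I)" "mult (quot_algebra A I) = mult (A Quot I)"
  "one (quot_algebra A I) = one (A Quot I)" "zero (quot_algebra A I) = zero (A Quot I)"
  "add (quot_algebra A I) = add (A Quot I)"
  "smult (quot_algebra A I) = (\<lambda>c X. \<Union>x\<in>X. I +>\<^bsub>A\<^esub> (c \<odot>\<^bsub>A\<^esub> x))"
  by (simp_all add: quot_algebra_def ring.defs)

lemma quot_algebra_smult:
  assumes A: "complex_algebra A" and I: "ideal I A" and x: "x \<in> carrier A"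
  shows "c \<odot>\<^bsub>quot_algebra A I\<^esub> (I +>\<^bsub>A\<^esub> x) = I +>\<^bsub>A\<^esub> (c \<odot>\<^bsub>A\<^esub> x)"
proof -
  interpret ideal I A by fact
  have cl: "c \<odot>\<^bsub>A\<^esub> y \<in> carrier A" if "y \<in> carrier A" for y
    using A that by (auto simp: complex_algebra_def)
  have *: "I +>\<^bsub>A\<^esub> (c \<odot>\<^bsub>A\<^esub> y) = I +>\<^bsub>A\<^esub> (c \<odot>\<^bsub>A\<^esub> x)" if y: "y \<in> I +>\<^bsub>A\<^esub> x" for y
  proof -
    obtain h where h: "h \<in> I" "y = h \<oplus>\<^bsub>A\<^esub> x"
      using y by (auto simp: a_r_coset_def')
    have hA: "h \<in> carrier A" using h by (simp add: a_Hcarr)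
    have "c \<odot>\<^bsub>A\<^esub> h = (c \<odot>\<^bsub>A\<^esub> \<one>\<^bsub>A\<^esub>) \<otimes>\<^bsub>A\<^esub> h"
      using A hA by (auto simp: complex_algebra_def)
    also have "\<dots> \<in> I" using h cl by (auto intro: I_l_closed)
    finally have hI: "c \<odot>\<^bsub>A\<^esub> h \<in> I" .
    have "c \<odot>\<^bsub>A\<^esub> y = (c \<odot>\<^bsub>A\<^esub> h) \<oplus>\<^bsub>A\<^esub> (c \<odot>\<^bsub>A\<^esub> x)"
      using A hA x h by (auto simp: complex_algebra_def)
    then have "c \<odot>\<^bsub>A\<^esub> y \<in> I +>\<^bsub>A\<^esub> (c \<odot>\<^bsub>A\<^esub> x)"
      using hI by (auto simp: a_r_coset_def')
    then show ?thesis
      using a_repr_independence[OF _ cl[OF x] a_subgroup] by simp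
  qed
  have "(\<Union>y\<in>I +>\<^bsub>A\<^esub> x. I +>\<^bsub>A\<^esub> (c \<odot>\<^bsub>A\<^esub> y)) = I +>\<^bsub>A\<^esub> (c \<odot>\<^bsub>A\<^esub> x)"
    by (rule UN_constant_eq[OF a_rcos_self[OF x]]) (intro ballI *)
  then show ?thesis by simp
qed

lemma complex_algebra_quot:
  assumes A: "complex_algebra A" and I: "ideal I A"
  shows "complex_algebra (quot_algebra A I)"
proof -
  interpret ideal I A by fact
  let ?Q = "quot_algebra A I"
  have R: "ring ?Q"
  proof -
    interpret Q: ring "A Quot I" by (rule quotient_is_ring)
    have "abelian_group ?Q"
    proof (rule abelian_groupI)
      fix X assume "X \<in> carrier ?Q"
      then show "\<exists>Y\<in>carrier ?Q. Y \<oplus>\<^bsub>?Q\<^esub> X = \<zero>\<^bsub>?Q\<^esub>"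
        using Q.l_neg[of X] Q.a_inv_closed[of X] by auto
    qed (simp_all add: Q.a_ac)
    moreover have "Group.monoid ?Q"
      by (rule monoidI) (auto simp: Q.m_assoc)
    ultimately show ?thesis
      by (rule ringI) (auto simp: Q.l_distr Q.r_distr)
  qed
  have car: "(\<forall>X\<in>carrier ?Q. P X) \<longleftrightarrow> (\<forall>x\<in>carrier A. P (I +>\<^bsub>A\<^esub> x))" for P
    by (auto simp: FactRing_def A_RCOSETS_def')
  have carI: "I +>\<^bsub>A\<^esub> x \<in> carrier ?Q" if "x \<in> carrier A" for x
    using that by (auto simp: FactRing_def A_RCOSETS_def')
  note sm = quot_algebra_smult[OF A I]
  have ad: "(I +>\<^bsub>A\<^esub> x) \<oplus>\<^bsub>?Q\<^esub> (I +>\<^bsub>A\<^esub> y) = I +>\<^bsub>A\<^esub> (x \<oplus>\<^bsub>A\<^esub> y)"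
    if "x \<in> carrier A" "y \<in> carrier A" for x y
    using that by (simp add: FactRing_def a_rcos_sum)
  have mu: "(I +>\<^bsub>A\<^esub> x) \<otimes>\<^bsub>?Q\<^esub> (I +>\<^bsub>A\<^esub> y) = I +>\<^bsub>A\<^esub> (x \<otimes>\<^bsub>A\<^esub> y)"
    if "x \<in> carrier A" "y \<in> carrier A" for x y
    using that by (simp add: FactRing_def rcoset_mult_add)
  show ?thesis
    unfolding complex_algebra_def car
    using A unfolding complex_algebra_def
    by (intro conjI ballI allI R) (simp_all add: sm ad mu carI del: quot_algebra_simps)
qed

lemma complex_algebra_presented:
  "S \<subseteq> carrier (free_algebra G) \<Longrightarrow> complex_algebra (presented G S)"
  unfolding presented_def
  by (intro complex_algebra_quot complex_algebra_free_algebra ring.genideal_ideal ring_free_algebra)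


section \<open>Roots of unity, quantum integers and Gaussian binomials\<close>

definition primitive_root_of_unity :: "nat \<Rightarrow> complex \<Rightarrow> bool" where
  "primitive_root_of_unity l z \<longleftrightarrow> l > 0 \<and> z ^ l = 1 \<and> (\<forall>k. 0 < k \<and> k < l \<longrightarrow> z ^ k \<noteq> 1)"

definition qint :: "complex \<Rightarrow> nat \<Rightarrow> complex" where
  "qint z m = (z powi int m - z powi (- int m)) / (z - inverse z)"

definition qfact :: "complex \<Rightarrow> nat \<Rightarrow> complex" where
  "qfact z m = (\<Prod>k=1..m. qint z k)"

text \<open>
  The element \<open>[X; s; a]\<close>, with the inverse \<open>Y\<close> of \<open>X\<close> passed explicitly: it is
  used to write down relations in a free algebra, where \<open>X\<close> is not yet invertible.
\<close>

definition qbin :: "complex \<Rightarrow> 'g falg \<Rightarrow> 'g falg \<Rightarrow> int \<Rightarrow> nat \<Rightarrow> 'g falg" where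
  "qbin z X Y s a =
     prod_list (map (\<lambda>j. scal (1 / (z powi int j - z powi (- int j))) *
        (scal (z powi (s - int j + 1)) * X - scal (z powi (- s + int j - 1)) * Y)) [1..<Suc a])"

text \<open>The \<open>i\<close>-th base-\<open>l\<close> digit of a non-negative integer.\<close>

definition digit :: "nat \<Rightarrow> int \<Rightarrow> nat \<Rightarrow> nat" where
  "digit l m i = nat (m div int l ^ i mod int l)"


section \<open>The small quantum group of sl2\<close>

datatype u_gen = UE | UF | UK

text \<open>By the relation \<open>K ^ l = 1\<close>, the inverse of \<open>K\<close> is \<open>K ^ (l - 1)\<close>.\<close>

definition u_rels :: "complex \<Rightarrow> nat \<Rightarrow> u_gen falg set" where
  "u_rels z l =
     { gen UK ^ l - 1,
       gen UK * gen UF - scal (z powi (-2)) * (gen UF * gen UK),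
       gen UK * gen UE - scal (z powi 2) * (gen UE * gen UK),
       gen UE ^ l,
       gen UF ^ l,
       gen UE * gen UF - gen UF * gen UE
         - scal (1 / (z - inverse z)) * (gen UK - gen UK ^ (l - 1)) }"

definition u_alg :: "complex \<Rightarrow> nat \<Rightarrow> (complex, u_gen falg set) module" where
  "u_alg z l = presented UNIV (u_rels z l)"

definition uE :: "complex \<Rightarrow> nat \<Rightarrow> u_gen falg set" where
  "uE z l = presented_cls UNIV (u_rels z l) (gen UE)"

definition uF :: "complex \<Rightarrow> nat \<Rightarrow> u_gen falg set" where
  "uF z l = presented_cls UNIV (u_rels z l) (gen UF)"

definition uK :: "complex \<Rightarrow> nat \<Rightarrow> u_gen falg set" where
  "uK z l = presented_cls UNIV (u_rels z l) (gen UK)"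


lemma complex_algebra_u_alg: "complex_algebra (u_alg z l)"
  unfolding u_alg_def by (rule complex_algebra_presented) (auto simp: u_rels_def)

section \<open>The algebras D\<close>

datatype d_gen = DE nat | DF nat | DK nat

definition d_gens :: "nat \<Rightarrow> d_gen set" where
  "d_gens N = DE ` {..N} \<union> DF ` {..N} \<union> DK ` {..N}"

text \<open>
  Divided powers and Gaussian brackets. The products run over \<open>i = 0, ..., N\<close> in increasing
  order; their factors commute modulo the relations below. As above, the inverse of
  \<open>K^[i]\<close> is its \<open>(l - 1)\<close>-st power, by the relation \<open>(K^[i])^l = 1\<close>.
\<close>

definition dE_div :: "complex \<Rightarrow> nat \<Rightarrow> nat \<Rightarrow> nat \<Rightarrow> d_gen falg" where
  "dE_div z l N m = prod_list (map (\<lambda>i. scal (1 / qfact z (digit l (int m) i)) *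
     gen (DE i) ^ digit l (int m) i) [0..<Suc N])"

definition dF_div :: "complex \<Rightarrow> nat \<Rightarrow> nat \<Rightarrow> nat \<Rightarrow> d_gen falg" where
  "dF_div z l N m = prod_list (map (\<lambda>i. scal (1 / qfact z (digit l (int m) i)) *
     gen (DF i) ^ digit l (int m) i) [0..<Suc N])"

definition dK_bin :: "complex \<Rightarrow> nat \<Rightarrow> nat \<Rightarrow> int \<Rightarrow> nat \<Rightarrow> d_gen falg" where
  "dK_bin z l N s t = prod_list (map (\<lambda>i. qbin z (gen (DK i)) (gen (DK i) ^ (l - 1))
     (int (digit l (s mod int l ^ Suc N) i)) (digit l (int t) i)) [0..<Suc N])"

definition d_rels :: "complex \<Rightarrow> nat \<Rightarrow> nat \<Rightarrow> d_gen falg set" where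
  "d_rels z l N =
     (\<Union>i\<in>{..N}. \<Union>j\<in>{..N}.
       { gen (DK i) * gen (DK j) - gen (DK j) * gen (DK i),
         gen (DK i) * gen (DE j) - scal (z powi (if i = j then 2 else 0)) * (gen (DE j) * gen (DK i)),
         gen (DK i) * gen (DF j) - scal (z powi (if i = j then -2 else 0)) * (gen (DF j) * gen (DK i)),
         gen (DE i) * gen (DE j) - gen (DE j) * gen (DE i),
         gen (DF i) * gen (DF j) - gen (DF j) * gen (DF i) }) \<union>
     (\<Union>i\<in>{..N}. { gen (DK i) ^ l - 1, gen (DE i) ^ l, gen (DF i) ^ l }) \<union>
     (\<Union>i\<in>{..N}. \<Union>j\<in>{..N} - {i}. { gen (DE i) * gen (DF j) - gen (DF j) * gen (DE i) }) \<union>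
     (\<Union>j\<in>{..N}. { gen (DE j) * gen (DF j) -
         (\<Sum>t=0..l ^ j. dF_div z l N (l ^ j - t) * dK_bin z l N (2 * int t - 2 * int l ^ j) t *
            dE_div z l N (l ^ j - t)) })"

definition d_alg :: "complex \<Rightarrow> nat \<Rightarrow> nat \<Rightarrow> (complex, d_gen falg set) module" where
  "d_alg z l N = presented (d_gens N) (d_rels z l N)"

definition dE :: "complex \<Rightarrow> nat \<Rightarrow> nat \<Rightarrow> nat \<Rightarrow> d_gen falg set" where
  "dE z l N i = presented_cls (d_gens N) (d_rels z l N) (gen (DE i))"

definition dF :: "complex \<Rightarrow> nat \<Rightarrow> nat \<Rightarrow> nat \<Rightarrow> d_gen falg set" where
  "dF z l N i = presented_cls (d_gens N) (d_rels z l N) (gen (DF i))"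

definition dK :: "complex \<Rightarrow> nat \<Rightarrow> nat \<Rightarrow> nat \<Rightarrow> d_gen falg set" where
  "dK z l N i = presented_cls (d_gens N) (d_rels z l N) (gen (DK i))"

lemma complex_algebra_d_alg: "complex_algebra (d_alg z l N)"
proof -
  have g: "DE i \<in> d_gens N" "DF i \<in> d_gens N" "DK i \<in> d_gens N" if "i \<le> N" for i
    using that by (auto simp: d_gens_def)
  have "dE_div z l N m \<in> carrier (free_algebra (d_gens N))" for m
    unfolding dE_div_def
    by (rule free_algebra_prod_list_closed) (auto simp: g simp del: upt_Suc)
  moreover have "dF_div z l N m \<in> carrier (free_algebra (d_gens N))" for m
    unfolding dF_div_def
    by (rule free_algebra_prod_list_closed) (auto simp: g simp del: upt_Suc)
  moreover have "dK_bin z l N s t \<in> carrier (free_algebra (d_gens N))" for s t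
    unfolding dK_bin_def qbin_def
    by (rule free_algebra_prod_list_closed)+ (auto simp: g simp del: upt_Suc)
  ultimately have "d_rels z l N \<subseteq> carrier (free_algebra (d_gens N))"
    by (auto simp: d_rels_def g)
  then show ?thesis
    unfolding d_alg_def by (rule complex_algebra_presented)
qed

end

theory Submission
  imports Defs
begin

text \<open>
  Send the generators of the lowest \<open>d = N - M\<close> levels to \<open>E = F = 0\<close>, \<open>K = 1\<close> and lower
  the index of the others by \<open>d\<close>. This defines a homomorphism of free algebras
  (\<open>lower_hom\<close>), and it maps every defining relation of \<open>D_N\<close> to 0 or literally to a
  relation of \<open>D_M\<close> (\<open>lower_hom_d_rels\<close>), so it descends to the quotients; it is
  surjective because every letter of the target is the image of a letter.

  Only the relation between \<open>E^[j]\<close> and \<open>F^[j]\<close> needs an argument. The divided power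
  \<open>F^(m)\<close> is sent to 0 as soon as one of the \<open>d\<close> lowest base-\<open>l\<close> digits of \<open>m\<close> is
  nonzero, that is, unless \<open>l^d\<close> divides \<open>m\<close>.

  \<^item> If \<open>j \<ge> d\<close>, the only terms that survive are those with \<open>t = l^d t'\<close>,
    \<open>0 \<le> t' \<le> l^(j-d)\<close>. Multiplication by \<open>l^d\<close> shifts digits by \<open>d\<close>, so the term for
    \<open>t\<close> is sent to the term for \<open>t'\<close> of the relation at level \<open>j - d\<close> in \<open>D_M\<close>
    (\<open>lower_hom_ef_sum_high\<close>).
  \<^item> If \<open>j < d\<close>, then \<open>0 < l^j - t \<le> l^j < l^d\<close> for \<open>t < l^j\<close>, so at most the term
    \<open>t = l^j\<close> survives, and this one is \<open>{K; 0; l^j} = [K^[j]; 0; 1]\<close>, which vanishes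
    at \<open>K^[j] = 1\<close> (\<open>lower_hom_ef_sum_low\<close>).

  The map to the small quantum group is the projection to \<open>D_0\<close> followed by the map
  \<open>D_0 \<rightarrow> u\<close> that renames the generators (\<open>d_alg_0_to_u_alg\<close>).
\<close>

section \<open>Homomorphisms of complex algebras and of their quotients\<close>

lemma ring_complex_algebra: "complex_algebra A \<Longrightarrow> ring A"
  by (simp add: complex_algebra_def)

lemma alg_surj_hom_compose:
  assumes f: "f \<in> alg_surj_hom A B" and g: "g \<in> alg_surj_hom B C"
  shows "g \<circ> f \<in> alg_surj_hom A C"
proof -
  have "g \<circ> f \<in> ring_hom A C"
    using f g by (auto simp: alg_surj_hom_def alg_hom_def intro: ring_hom_trans)
  moreover have "(g \<circ> f) ` carrier A = carrier C"
    using f g by (auto simp: alg_surj_hom_def simp flip: image_image)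
  moreover have "g (f (c \<odot>\<^bsub>A\<^esub> x)) = c \<odot>\<^bsub>C\<^esub> g (f x)" if "x \<in> carrier A" for c x
  proof -
    have "f x \<in> carrier B" using f that by (auto simp: alg_surj_hom_def)
    then show ?thesis using f g that by (simp add: alg_surj_hom_def alg_hom_def)
  qed
  ultimately show ?thesis
    by (simp add: alg_surj_hom_def alg_hom_def)
qed

lemma carrier_quot_algebra: "carrier (quot_algebra A I) = (\<lambda>x. I +>\<^bsub>A\<^esub> x) ` carrier A"
  by (auto simp: FactRing_def A_RCOSETS_def')

text \<open>
  The induced map takes a coset \<open>X\<close> to the union of the cosets of the \<open>f x\<close> with
  \<open>x \<in> X\<close>, which all coincide.
\<close>

lemma quot_algebra_surj_hom:
  fixes A :: "(complex, 'a) module" and B :: "(complex, 'b) module"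
  assumes A: "complex_algebra A" and B: "complex_algebra B"
    and I: "ideal I A" and J: "ideal J B"
    and f: "f \<in> alg_surj_hom A B" and fI: "f ` I \<subseteq> J"
  shows "\<exists>\<pi>\<in>alg_surj_hom (quot_algebra A I) (quot_algebra B J).
           \<forall>x\<in>carrier A. \<pi> (I +>\<^bsub>A\<^esub> x) = J +>\<^bsub>B\<^esub> f x"
proof -
  interpret I: ideal I A by fact
  interpret J: ideal J B by fact
  define \<pi> where "\<pi> X = (\<Union>x\<in>X. J +>\<^bsub>B\<^esub> f x)" for X
  have f_smult: "f (c \<odot>\<^bsub>A\<^esub> x) = c \<odot>\<^bsub>B\<^esub> f x" if "x \<in> carrier A" for c x
    using f that by (auto simp: alg_surj_hom_def alg_hom_def)
  have f_hom: "f \<in> ring_hom A B" and f_surj: "f ` carrier A = carrier B"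
    using f by (auto simp: alg_surj_hom_def alg_hom_def)
  note f_closed = ring_hom_closed[OF f_hom]
  have smult_closed: "c \<odot>\<^bsub>A\<^esub> x \<in> carrier A" if "x \<in> carrier A" for c x
    using A that by (auto simp: complex_algebra_def)
  have \<pi>: "\<pi> (I +>\<^bsub>A\<^esub> x) = J +>\<^bsub>B\<^esub> f x" if x: "x \<in> carrier A" for x
    unfolding \<pi>_def
  proof (rule UN_constant_eq[OF I.a_rcos_self[OF x]], intro ballI)
    fix y assume "y \<in> I +>\<^bsub>A\<^esub> x"
    then obtain h where h: "h \<in> I" "y = h \<oplus>\<^bsub>A\<^esub> x"
      by (auto simp: a_r_coset_def')
    then have "f y = f h \<oplus>\<^bsub>B\<^esub> f x"
      using x by (auto intro!: ring_hom_add[OF f_hom] simp: I.a_Hcarr)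
    then have "f y \<in> J +>\<^bsub>B\<^esub> f x"
      using h fI by (auto simp: a_r_coset_def')
    then show "J +>\<^bsub>B\<^esub> f y = J +>\<^bsub>B\<^esub> f x"
      using J.a_repr_independence[OF _ f_closed[OF x] J.a_subgroup] by simp
  qed
  have "\<pi> \<in> ring_hom (quot_algebra A I) (quot_algebra B J)"
  proof (rule ring_hom_memI)
    fix X assume "X \<in> carrier (quot_algebra A I)"
    then obtain x where x: "x \<in> carrier A" "X = I +>\<^bsub>A\<^esub> x"
      by (auto simp: carrier_quot_algebra simp del: quot_algebra_simps)
    then show "\<pi> X \<in> carrier (quot_algebra B J)"
      by (auto simp: carrier_quot_algebra \<pi> f_closed simp del: quot_algebra_simps)
    fix Y assume "Y \<in> carrier (quot_algebra A I)"
    then obtain y where y: "y \<in> carrier A" "Y = I +>\<^bsub>A\<^esub> y"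
      by (auto simp: carrier_quot_algebra simp del: quot_algebra_simps)
    show "\<pi> (X \<otimes>\<^bsub>quot_algebra A I\<^esub> Y) = \<pi> X \<otimes>\<^bsub>quot_algebra B J\<^esub> \<pi> Y"
      using x y
      by (simp add: FactRing_def I.rcoset_mult_add J.rcoset_mult_add \<pi> f_closed
          ring_hom_mult[OF f_hom])
    show "\<pi> (X \<oplus>\<^bsub>quot_algebra A I\<^esub> Y) = \<pi> X \<oplus>\<^bsub>quot_algebra B J\<^esub> \<pi> Y"
      using x y
      by (simp add: FactRing_def I.a_rcos_sum J.a_rcos_sum \<pi> f_closed ring_hom_add[OF f_hom])
  next
    show "\<pi> \<one>\<^bsub>quot_algebra A I\<^esub> = \<one>\<^bsub>quot_algebra B J\<^esub>"
      by (simp add: FactRing_def \<pi> ring_hom_one[OF f_hom])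
  qed
  moreover have "\<pi> (c \<odot>\<^bsub>quot_algebra A I\<^esub> X) = c \<odot>\<^bsub>quot_algebra B J\<^esub> \<pi> X"
    if "X \<in> carrier (quot_algebra A I)" for c X
  proof -
    from that obtain x where x: "x \<in> carrier A" "X = I +>\<^bsub>A\<^esub> x"
      by (auto simp: carrier_quot_algebra simp del: quot_algebra_simps)
    then show ?thesis
      by (simp add: quot_algebra_smult[OF A I] quot_algebra_smult[OF B J] \<pi> f_closed f_smult
          smult_closed del: quot_algebra_simps)
  qed
  moreover have "\<pi> ` carrier (quot_algebra A I) = carrier (quot_algebra B J)"
    unfolding carrier_quot_algebra f_surj[symmetric] by (auto simp: \<pi> image_image)
  ultimately show ?thesis
    using \<pi> by (intro bexI[of _ \<pi>])
      (simp_all add: alg_surj_hom_def alg_hom_def del: quot_algebra_simps)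
qed


section \<open>Homomorphisms out of free algebras and of presented algebras\<close>

text \<open>
  The algebra homomorphism between free algebras that extends a map from the letters; its value
  on a word is the product of the values on the letters.
\<close>

definition falg_lift :: "('g \<Rightarrow> 'h falg) \<Rightarrow> 'g falg \<Rightarrow> 'h falg" where
  "falg_lift h p =
     (\<Sum>w\<in>Poly_Mapping.keys p. scal (Poly_Mapping.lookup p w) * prod_list (map h (letters w)))"

text \<open>Every element of the free algebra is a finite sum of monomials.\<close>

lemma falg_induct [case_names zero add]:
  fixes p :: "'g falg"
  assumes "P 0" and "\<And>c w p. P p \<Longrightarrow> P (Poly_Mapping.single w c + p)"
  shows "P p"
proof (induction p rule: update_induct)
  case const
  then show ?case by (simp add: assms(1))
next
  case (update f a b)
  have "Poly_Mapping.update a b f = Poly_Mapping.single a b + f"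
    using update(1)
    by (intro poly_mapping_eqI)
       (auto simp: lookup_update lookup_add lookup_single when_def in_keys_iff)
  then show ?case using assms(2) update(3) by simp
qed

lemma scal_0 [simp]: "scal 0 = 0"
  by (simp add: scal_def)

lemma falg_lift_zero [simp]: "falg_lift h 0 = 0"
  by (simp add: falg_lift_def)

lemma falg_lift_single:
  "falg_lift h (Poly_Mapping.single w c) = scal c * prod_list (map h (letters w))"
  by (cases "c = 0") (simp_all add: falg_lift_def)

lemma falg_lift_add: "falg_lift h (p + q) = falg_lift h p + falg_lift h q"
  unfolding falg_lift_def
  by (rule setsum_keys_plus_distrib) (simp_all add: scal_add distrib_right)

lemma falg_lift_diff: "falg_lift h (p - q) = falg_lift h p - falg_lift h q"
  using falg_lift_add[of h "p - q" q] by simp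

lemma falg_lift_mult: "falg_lift h (p * q) = falg_lift h p * falg_lift h q"
proof (induction p rule: falg_induct)
  case (add c w p)
  have "falg_lift h (Poly_Mapping.single w c * q) =
          falg_lift h (Poly_Mapping.single w c) * falg_lift h q"
  proof (induction q rule: falg_induct)
    case (add d v q)
    let ?u = "prod_list (map h (letters w))"
    have "scal (c * d) * (?u * x) = scal c * ?u * (scal d * x)" for x
      by (simp add: scal_mult mult.assoc) (simp add: scal_commute[of ?u d] flip: mult.assoc)
    then show ?case
      using add
      by (simp add: distrib_left falg_lift_add falg_lift_single mult_single plus_fword_def)
  qed simp
  with add show ?case by (simp add: distrib_right falg_lift_add)
qed simp

lemma falg_lift_scal [simp]: "falg_lift h (scal c) = scal c"
  by (simp add: scal_def[of c] falg_lift_single) (simp add: zero_fword_def scal_def)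

lemma falg_lift_one [simp]: "falg_lift h 1 = 1"
  using falg_lift_scal[of h 1] by (simp add: scal_1)

lemma falg_lift_gen [simp]: "falg_lift h (gen g) = h g"
  by (simp add: gen_def falg_lift_single scal_1)

lemma falg_lift_power: "falg_lift h (p ^ n) = falg_lift h p ^ n"
  by (induction n) (simp_all add: falg_lift_mult)

lemma falg_lift_sum: "falg_lift h (sum f A) = (\<Sum>x\<in>A. falg_lift h (f x))"
  by (induction A rule: infinite_finite_induct) (simp_all add: falg_lift_add)

lemma falg_lift_prod_list:
  "falg_lift h (prod_list (map f xs)) = prod_list (map (\<lambda>x. falg_lift h (f x)) xs)"
  by (induction xs) (simp_all add: falg_lift_mult)

lemmas falg_lift_hom =
  falg_lift_add falg_lift_diff falg_lift_mult falg_lift_power falg_lift_sum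

lemma falg_lift_closed:
  assumes "\<And>g. g \<in> G \<Longrightarrow> h g \<in> carrier (free_algebra G')" and "p \<in> carrier (free_algebra G)"
  shows "falg_lift h p \<in> carrier (free_algebra G')"
  unfolding falg_lift_def using assms
  by (intro free_algebra_sum_closed free_algebra_mult_closed free_algebra_closed
      free_algebra_prod_list_closed) (auto simp: free_algebra_def)

lemma falg_lift_gen_id: "falg_lift gen p = p"
proof (induction p rule: falg_induct)
  case (add c w p)
  have "prod_list (map gen us) = Poly_Mapping.single (Fword us) (1::complex)" for us :: "'a list"
    by (induction us) (simp_all add: gen_def mult_single plus_fword_def flip: single_one zero_fword_def)
  then have "falg_lift gen (Poly_Mapping.single w c) = Poly_Mapping.single w c"
    by (simp add: falg_lift_single scal_def mult_single)
  with add show ?case by (simp add: falg_lift_add)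
qed simp

lemma falg_lift_compose: "falg_lift h (falg_lift k p) = falg_lift (\<lambda>g. falg_lift h (k g)) p"
  by (simp add: falg_lift_def[of k p] falg_lift_sum falg_lift_mult falg_lift_prod_list)
     (simp add: falg_lift_def)

lemma falg_lift_surj_hom:
  assumes closed: "\<And>g. g \<in> G \<Longrightarrow> h g \<in> carrier (free_algebra G')"
    and surj: "\<And>g'. g' \<in> G' \<Longrightarrow> gen g' \<in> h ` G"
  shows "falg_lift h \<in> alg_surj_hom (free_algebra G) (free_algebra G')"
proof -
  have "q \<in> falg_lift h ` carrier (free_algebra G)" if q: "q \<in> carrier (free_algebra G')" for q
  proof -
    \<comment> \<open>a choice of preimages of the letters extends to a section\<close>
    define k where "k g' = inv_into G h (gen g')" for g'
    have k: "k g' \<in> G" "h (k g') = gen g'" if "g' \<in> G'" for g'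
      using surj[OF that] by (simp_all add: k_def inv_into_into f_inv_into_f)
    let ?p = "falg_lift (\<lambda>g'. gen (k g')) q"
    have "falg_lift h ?p = falg_lift (\<lambda>g'. h (k g')) q"
      by (simp add: falg_lift_compose)
    also have "\<dots> = falg_lift gen q"
      unfolding falg_lift_def using q k
      by (intro sum.cong refl arg_cong2[where f = "(*)"] arg_cong[where f = prod_list] map_cong)
         (auto simp: free_algebra_def)
    finally have "falg_lift h ?p = q" by (simp add: falg_lift_gen_id)
    moreover have "?p \<in> carrier (free_algebra G)"
      using q k by (intro falg_lift_closed[where G = G']) auto
    ultimately show ?thesis by (metis imageI)
  qed
  moreover have "falg_lift h ` carrier (free_algebra G) \<subseteq> carrier (free_algebra G')"
    by (intro image_subsetI falg_lift_closed[where G = G] closed)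
  ultimately show ?thesis
    unfolding alg_surj_hom_def alg_hom_def by (auto intro!: ring_hom_memI simp: falg_lift_hom)
qed

lemma ideal_genideal_free_algebra:
  "S \<subseteq> carrier (free_algebra G) \<Longrightarrow> ideal (Idl\<^bsub>free_algebra G\<^esub> S) (free_algebra G)"
  by (intro ring.genideal_ideal ring_free_algebra)

text \<open>
  The universal property of a presentation: a map on the letters that sends each relation to 0 or
  to a relation of the target, and attains every letter of the target, induces a surjective
  homomorphism.
\<close>

lemma presented_surj_hom:
  fixes h :: "'g \<Rightarrow> 'h falg"
  assumes S: "S \<subseteq> carrier (free_algebra G)" and S': "S' \<subseteq> carrier (free_algebra G')"
    and closed: "\<And>g. g \<in> G \<Longrightarrow> h g \<in> carrier (free_algebra G')"
    and surj: "\<And>g'. g' \<in> G' \<Longrightarrow> gen g' \<in> h ` G"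
    and rels: "\<And>r. r \<in> S \<Longrightarrow> falg_lift h r \<in> insert 0 S'"
  shows "\<exists>\<pi>\<in>alg_surj_hom (presented G S) (presented G' S').
           \<forall>p\<in>carrier (free_algebra G). \<pi> (presented_cls G S p) = presented_cls G' S' (falg_lift h p)"
proof -
  let ?A = "free_algebra G" and ?B = "free_algebra G'"
  let ?J = "Idl\<^bsub>?B\<^esub> S'"
  interpret J: ideal ?J ?B by (rule ideal_genideal_free_algebra[OF S'])
  have f: "falg_lift h \<in> alg_surj_hom ?A ?B"
    by (rule falg_lift_surj_hom[OF closed surj])
  then interpret f: ring_hom_ring ?A ?B "falg_lift h"
    by (intro ring_hom_ringI2 ring_free_algebra) (simp add: alg_surj_hom_def alg_hom_def)
  have "0 \<in> ?J" using additive_subgroup.zero_closed[OF J.is_additive_subgroup] by simp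
  then have "S \<subseteq> {r \<in> carrier ?A. falg_lift h r \<in> ?J}"
    using rels S J.genideal_self[OF S'] by fastforce
  then have "Idl\<^bsub>?A\<^esub> S \<subseteq> {r \<in> carrier ?A. falg_lift h r \<in> ?J}"
    by (intro f.R.genideal_minimal f.ideal_vimage J.ideal_axioms)
  then show ?thesis
    unfolding presented_def presented_cls_def
    by (intro quot_algebra_surj_hom complex_algebra_free_algebra ideal_genideal_free_algebra S S' f)
       auto
qed

lemma presented_cls_zero:
  assumes "S \<subseteq> carrier (free_algebra G)"
  shows "presented_cls G S 0 = \<zero>\<^bsub>presented G S\<^esub>"
proof -
  interpret ideal "Idl\<^bsub>free_algebra G\<^esub> S" "free_algebra G"
    by (rule ideal_genideal_free_algebra[OF assms])
  show ?thesis
    using a_coset_add_zero[OF a_subset]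
    by (simp add: presented_cls_def presented_def FactRing_def)
qed

lemma presented_cls_one: "presented_cls G S 1 = \<one>\<^bsub>presented G S\<^esub>"
  by (simp add: presented_cls_def presented_def FactRing_def)


section \<open>Base-\<open>l\<close> digits\<close>

lemma digit_mult_power_low:
  assumes "l > 0" "i < d"
  shows "digit l (int l ^ d * m) i = 0"
proof -
  have "d = i + 1 + (d - i - 1)" using assms by simp
  then have "int l ^ d = int l ^ i * int l * int l ^ (d - i - 1)"
    by (metis power_add power_one_right)
  with assms show ?thesis by (simp add: digit_def mult.assoc)
qed

lemma digit_mult_power_high:
  assumes "l > 0"
  shows "digit l (int l ^ d * m) (i + d) = digit l m i"
  using assms by (simp add: digit_def power_add mult.commute[of "int l ^ i"])

lemma power_dvd_of_digits_zero:
  assumes "l > 0" and "\<And>i. i < d \<Longrightarrow> digit l (int m) i = 0"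
  shows "l ^ d dvd m"
  using assms(2)
proof (induction d)
  case (Suc d)
  then have "l ^ d dvd m" by simp
  then obtain k where k: "m = l ^ d * k" by blast
  have "digit l (int m) d = 0" using Suc by simp
  then have "int k mod int l = 0" using assms(1) by (simp add: k digit_def flip: of_nat_mod)
  then have "l dvd k" by (metis dvd_eq_mod_eq_0 of_nat_0_eq_iff of_nat_mod)
  then show ?case by (simp add: k mult.commute)
qed simp


section \<open>The relations under the shift of the levels\<close>

text \<open>
  The map on the letters that defines the projection: the lowest \<open>d\<close> levels are sent to
  \<open>E = F = 0\<close> and \<open>K = 1\<close>, and the others are lowered by \<open>d\<close>.
\<close>

fun lower :: "nat \<Rightarrow> d_gen \<Rightarrow> d_gen falg" where
  "lower d (DE i) = (if i < d then 0 else gen (DE (i - d)))"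
| "lower d (DF i) = (if i < d then 0 else gen (DF (i - d)))"
| "lower d (DK i) = (if i < d then 1 else gen (DK (i - d)))"

abbreviation lower_hom :: "nat \<Rightarrow> d_gen falg \<Rightarrow> d_gen falg" where
  "lower_hom d \<equiv> falg_lift (lower d)"

lemma falg_lift_qbin:
  "falg_lift h (qbin z X Y s a) = qbin z (falg_lift h X) (falg_lift h Y) s a"
  by (simp add: qbin_def falg_lift_prod_list falg_lift_hom del: upt_Suc)

text \<open>The trivial factors at the \<open>d\<close> lowest levels of a product over the levels can be dropped.\<close>

lemma prod_list_upt_drop:
  fixes f :: "nat \<Rightarrow> 'a::monoid_mult"
  assumes "\<And>i. i < d \<Longrightarrow> f i = 1"
  shows "prod_list (map f [0..<Suc (M + d)]) = prod_list (map (\<lambda>i. f (i + d)) [0..<Suc M])"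
proof -
  have "[0..<Suc (M + d)] = [0..<d] @ map (\<lambda>i. i + d) [0..<Suc M]"
    using upt_add_eq_append[of 0 d "Suc M"]
    by (simp add: map_add_upt add.commute del: upt_Suc)
  moreover have "prod_list (map f [0..<d]) = 1"
    using assms by (induction d) auto
  ultimately show ?thesis by (simp add: comp_def del: upt_Suc)
qed

lemma prod_list_eq_zero:
  fixes f :: "'b \<Rightarrow> 'a::semiring_1"
  assumes "x \<in> set xs" "f x = 0"
  shows "prod_list (map f xs) = 0"
  using assms by (induction xs) auto

lemma qfact_0 [simp]: "qfact z 0 = 1"
  by (simp add: qfact_def)

lemma qbin_0 [simp]: "qbin z X Y s 0 = 1"
  by (simp add: qbin_def)

lemma lower_hom_divided_power:
  assumes "l > 0"
  shows "lower_hom d (dE_div z l (M + d) (l ^ d * m)) = dE_div z l M m"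
    and "lower_hom d (dF_div z l (M + d) (l ^ d * m)) = dF_div z l M m"
  unfolding dE_div_def dF_div_def falg_lift_prod_list
  using assms
  by (subst prod_list_upt_drop;
      simp add: falg_lift_hom digit_mult_power_low digit_mult_power_high scal_1 del: upt_Suc)+

lemma lower_hom_dF_div_eq_zero:
  assumes "l > 0" "d \<le> N" "\<not> l ^ d dvd m"
  shows "lower_hom d (dF_div z l N m) = 0"
proof -
  obtain i where "i < d" "digit l (int m) i \<noteq> 0"
    using power_dvd_of_digits_zero assms by blast
  then show ?thesis
    unfolding dF_div_def falg_lift_prod_list using assms
    by (intro prod_list_eq_zero[of i]) (auto simp: falg_lift_hom zero_power simp del: upt_Suc)
qed

lemma lower_hom_dK_bin:
  assumes "l > 0"
  shows "lower_hom d (dK_bin z l (M + d) (int l ^ d * s) (l ^ d * t)) = dK_bin z l M s t"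
proof -
  have "int l ^ d * s mod int l ^ Suc (M + d) = int l ^ d * (s mod int l ^ Suc M)"
    by (simp add: power_add mult.commute[of _ "int l ^ d"] mult.left_commute[of _ "int l ^ d"]
        flip: mult_mod_right)
  then show ?thesis
    unfolding dK_bin_def falg_lift_prod_list using assms
    by (subst prod_list_upt_drop)
       (simp_all add: falg_lift_qbin falg_lift_hom digit_mult_power_low digit_mult_power_high
         del: upt_Suc power_Suc)
qed

text \<open>
  For \<open>j < d\<close>, the element \<open>{K; 0; l^j}\<close> has the factor \<open>[K^[j]; 0; 1]\<close>, a multiple of
  \<open>K^[j] - (K^[j])^-1\<close>, which dies when \<open>K^[j]\<close> is sent to 1.
\<close>

lemma lower_hom_dK_bin_eq_zero:
  assumes "l > 1" "j < d" "d \<le> N"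
  shows "lower_hom d (dK_bin z l N 0 (l ^ j)) = 0"
proof -
  have "digit l (int (l ^ j)) j = 1" "digit l 0 j = 0"
    using assms by (simp_all add: digit_def)
  then show ?thesis
    unfolding dK_bin_def falg_lift_prod_list using assms
    by (intro prod_list_eq_zero[of j])
       (auto simp: falg_lift_qbin falg_lift_hom qbin_def simp del: of_nat_power)
qed

text \<open>The expression of \<open>E^[j] F^[j]\<close> in the relations of \<open>D_N\<close>.\<close>

definition ef_sum :: "complex \<Rightarrow> nat \<Rightarrow> nat \<Rightarrow> nat \<Rightarrow> d_gen falg" where
  "ef_sum z l N j = (\<Sum>t=0..l ^ j. dF_div z l N (l ^ j - t) *
     dK_bin z l N (2 * int t - 2 * int l ^ j) t * dE_div z l N (l ^ j - t))"

lemma lower_hom_ef_sum_low: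
  assumes "l > 1" "j < d" "d \<le> N"
  shows "lower_hom d (ef_sum z l N j) = 0"
  unfolding ef_sum_def falg_lift_sum
proof (intro sum.neutral ballI)
  fix t assume t: "t \<in> {0..l ^ j}"
  show "lower_hom d (dF_div z l N (l ^ j - t) *
     dK_bin z l N (2 * int t - 2 * int l ^ j) t * dE_div z l N (l ^ j - t)) = 0"
  proof (cases "t = l ^ j")
    case True
    then show ?thesis using lower_hom_dK_bin_eq_zero[OF assms] by (simp add: falg_lift_hom)
  next
    case False
    have "l ^ j < l ^ d" using assms by (simp add: power_strict_increasing)
    with t False have "\<not> l ^ d dvd l ^ j - t" by (auto dest!: dvd_imp_le)
    then show ?thesis
      using assms by (simp add: falg_lift_hom lower_hom_dF_div_eq_zero)
  qed
qed

lemma lower_hom_ef_sum_high: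
  assumes l: "l > 0" and "d \<le> j"
  shows "lower_hom d (ef_sum z l (M + d) j) = ef_sum z l M (j - d)"
proof -
  define f where "f t = lower_hom d (dF_div z l (M + d) (l ^ j - t) *
     dK_bin z l (M + d) (2 * int t - 2 * int l ^ j) t * dE_div z l (M + d) (l ^ j - t))" for t
  have j: "l ^ j = l ^ d * l ^ (j - d)"
    using assms by (simp flip: power_add)
  \<comment> \<open>only the multiples of \<open>l ^ d\<close> contribute\<close>
  have vanish: "f t = 0" if "t \<in> {0..l ^ j}" "\<not> l ^ d dvd t" for t
  proof -
    have "\<not> l ^ d dvd l ^ j - t"
      using that j by (metis atLeastAtMost_iff dvd_diffD1 dvd_triv_left)
    then show ?thesis using l by (simp add: f_def falg_lift_hom lower_hom_dF_div_eq_zero)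
  qed
  have image: "(\<lambda>t. l ^ d * t) ` {0..l ^ (j - d)} = {t \<in> {0..l ^ j}. l ^ d dvd t}"
    using l by (auto simp: j)
  have "lower_hom d (ef_sum z l (M + d) j) = (\<Sum>t\<in>{0..l ^ j}. f t)"
    by (simp add: ef_sum_def f_def falg_lift_sum)
  also have "\<dots> = (\<Sum>t\<in>{t \<in> {0..l ^ j}. l ^ d dvd t}. f t)"
    using vanish by (intro sum.mono_neutral_right) auto
  also have "\<dots> = (\<Sum>t\<in>{0..l ^ (j - d)}. f (l ^ d * t))"
    unfolding image[symmetric] using l by (subst sum.reindex) (auto simp: inj_on_def)
  also have "\<dots> = ef_sum z l M (j - d)"
    unfolding ef_sum_def
  proof (rule sum.cong[OF refl])
    fix t
    have "l ^ j - l ^ d * t = l ^ d * (l ^ (j - d) - t)"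
      by (simp only: j diff_mult_distrib2)
    moreover have "2 * int (l ^ d * t) - 2 * int l ^ j =
        int l ^ d * (2 * int t - 2 * int l ^ (j - d))"
    proof -
      have "int l ^ j = int l ^ d * int l ^ (j - d)"
        using j by (metis of_nat_mult of_nat_power)
      then show ?thesis by (simp only: of_nat_mult of_nat_power right_diff_distrib mult.left_commute)
    qed
    ultimately show "f (l ^ d * t) = dF_div z l M (l ^ (j - d) - t) *
        dK_bin z l M (2 * int t - 2 * int l ^ (j - d)) t * dE_div z l M (l ^ (j - d) - t)"
      using l by (simp add: f_def falg_lift_mult lower_hom_divided_power lower_hom_dK_bin
          del: of_nat_mult)
  qed
  finally show ?thesis .
qed

text \<open>The relations of \<open>D_N\<close>, with the last sum abbreviated.\<close>

lemma d_rels_eq: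
  "d_rels z l N =
     (\<Union>i\<in>{..N}. \<Union>j\<in>{..N}.
       { gen (DK i) * gen (DK j) - gen (DK j) * gen (DK i),
         gen (DK i) * gen (DE j) - scal (z powi (if i = j then 2 else 0)) * (gen (DE j) * gen (DK i)),
         gen (DK i) * gen (DF j) - scal (z powi (if i = j then -2 else 0)) * (gen (DF j) * gen (DK i)),
         gen (DE i) * gen (DE j) - gen (DE j) * gen (DE i),
         gen (DF i) * gen (DF j) - gen (DF j) * gen (DF i) }) \<union>
     (\<Union>i\<in>{..N}. { gen (DK i) ^ l - 1, gen (DE i) ^ l, gen (DF i) ^ l }) \<union>
     (\<Union>i\<in>{..N}. \<Union>j\<in>{..N} - {i}. { gen (DE i) * gen (DF j) - gen (DF j) * gen (DE i) }) \<union>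
     (\<Union>j\<in>{..N}. { gen (DE j) * gen (DF j) - ef_sum z l N j })"
  unfolding d_rels_def ef_sum_def ..

lemma d_gens_mem [simp]:
  "DE i \<in> d_gens N \<longleftrightarrow> i \<le> N" "DF i \<in> d_gens N \<longleftrightarrow> i \<le> N" "DK i \<in> d_gens N \<longleftrightarrow> i \<le> N"
  by (auto simp: d_gens_def)

lemma d_rels_closed: "d_rels z l N \<subseteq> carrier (free_algebra (d_gens N))"
proof -
  have "ef_sum z l N j \<in> carrier (free_algebra (d_gens N))" for j
    unfolding ef_sum_def dE_div_def dF_div_def dK_bin_def qbin_def
    by (intro free_algebra_sum_closed free_algebra_mult_closed free_algebra_prod_list_closed)
       (auto simp del: upt_Suc)
  then show ?thesis by (auto simp: d_rels_eq)
qed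

text \<open>To prove a property of all relations, it suffices to treat the ten families.\<close>

lemma d_rels_induct [consumes 1, case_names KK KE KF EE FF K E F EF EF_same]:
  assumes "r \<in> d_rels z l N"
    and "\<And>i j. i \<le> N \<Longrightarrow> j \<le> N \<Longrightarrow> P (gen (DK i) * gen (DK j) - gen (DK j) * gen (DK i))"
    and "\<And>i j. i \<le> N \<Longrightarrow> j \<le> N \<Longrightarrow> P (gen (DK i) * gen (DE j) -
           scal (z powi (if i = j then 2 else 0)) * (gen (DE j) * gen (DK i)))"
    and "\<And>i j. i \<le> N \<Longrightarrow> j \<le> N \<Longrightarrow> P (gen (DK i) * gen (DF j) -
           scal (z powi (if i = j then -2 else 0)) * (gen (DF j) * gen (DK i)))"
    and "\<And>i j. i \<le> N \<Longrightarrow> j \<le> N \<Longrightarrow> P (gen (DE i) * gen (DE j) - gen (DE j) * gen (DE i))"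
    and "\<And>i j. i \<le> N \<Longrightarrow> j \<le> N \<Longrightarrow> P (gen (DF i) * gen (DF j) - gen (DF j) * gen (DF i))"
    and "\<And>i. i \<le> N \<Longrightarrow> P (gen (DK i) ^ l - 1)"
    and "\<And>i. i \<le> N \<Longrightarrow> P (gen (DE i) ^ l)"
    and "\<And>i. i \<le> N \<Longrightarrow> P (gen (DF i) ^ l)"
    and "\<And>i j. i \<le> N \<Longrightarrow> j \<le> N \<Longrightarrow> j \<noteq> i \<Longrightarrow>
           P (gen (DE i) * gen (DF j) - gen (DF j) * gen (DE i))"
    and "\<And>j. j \<le> N \<Longrightarrow> P (gen (DE j) * gen (DF j) - ef_sum z l N j)"
  shows "P r"
proof -
  have "\<forall>r\<in>d_rels z l N. P r"
    unfolding d_rels_eq ball_Un ball_UN ball_simps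
    by (intro conjI ballI TrueI; rule assms(2-); simp)
  with assms(1) show ?thesis by blast
qed

text \<open>
  The premise on \<open>j\<close> is idle in the conclusions that do not mention \<open>j\<close>.
\<close>

lemma d_rels_intros:
  assumes "i \<le> N" "j \<le> N"
  shows
    "gen (DK i) * gen (DK j) - gen (DK j) * gen (DK i) \<in> d_rels z l N"
    "gen (DK i) * gen (DE j) - scal (z powi (if i = j then 2 else 0)) * (gen (DE j) * gen (DK i))
       \<in> d_rels z l N"
    "gen (DK i) * gen (DF j) - scal (z powi (if i = j then -2 else 0)) * (gen (DF j) * gen (DK i))
       \<in> d_rels z l N"
    "gen (DE i) * gen (DE j) - gen (DE j) * gen (DE i) \<in> d_rels z l N"
    "gen (DF i) * gen (DF j) - gen (DF j) * gen (DF i) \<in> d_rels z l N"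
    "gen (DK i) ^ l - 1 \<in> d_rels z l N"
    "gen (DE i) ^ l \<in> d_rels z l N"
    "gen (DF i) ^ l \<in> d_rels z l N"
    "j \<noteq> i \<Longrightarrow> gen (DE i) * gen (DF j) - gen (DF j) * gen (DE i) \<in> d_rels z l N"
    "gen (DE i) * gen (DF i) - ef_sum z l N i \<in> d_rels z l N"
proof -
  \<comment> \<open>naming the set allows the other occurrence of it to be unfolded alone\<close>
  define S where "S = d_rels z l N"
  have "\<forall>r\<in>d_rels z l N. r \<in> S" by (simp add: S_def)
  note rels = this[unfolded d_rels_eq ball_Un ball_UN ball_simps]
  show
    "gen (DK i) * gen (DK j) - gen (DK j) * gen (DK i) \<in> d_rels z l N"
    "gen (DK i) * gen (DE j) - scal (z powi (if i = j then 2 else 0)) * (gen (DE j) * gen (DK i))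
       \<in> d_rels z l N"
    "gen (DK i) * gen (DF j) - scal (z powi (if i = j then -2 else 0)) * (gen (DF j) * gen (DK i))
       \<in> d_rels z l N"
    "gen (DE i) * gen (DE j) - gen (DE j) * gen (DE i) \<in> d_rels z l N"
    "gen (DF i) * gen (DF j) - gen (DF j) * gen (DF i) \<in> d_rels z l N"
    "gen (DK i) ^ l - 1 \<in> d_rels z l N"
    "gen (DE i) ^ l \<in> d_rels z l N"
    "gen (DF i) ^ l \<in> d_rels z l N"
    "j \<noteq> i \<Longrightarrow> gen (DE i) * gen (DF j) - gen (DF j) * gen (DE i) \<in> d_rels z l N"
    "gen (DE i) * gen (DF i) - ef_sum z l N i \<in> d_rels z l N"
    unfolding S_def[symmetric] using rels assms by simp_all
qed

lemma lower_hom_d_rels: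
  assumes l: "l > 1" and "r \<in> d_rels z l (M + d)"
  shows "lower_hom d r \<in> insert 0 (d_rels z l M)"
  using assms(2)
proof (induction rule: d_rels_induct)
  case (KK i j)
  then show ?case
    using d_rels_intros(1)[of "i - d" M "j - d" z l]
    by (cases "i < d"; cases "j < d") (simp_all add: falg_lift_hom)
next
  case (KE i j)
  then show ?case
    using d_rels_intros(2)[of "i - d" M "j - d" z l]
    by (cases "i < d"; cases "j < d") (simp_all add: falg_lift_hom scal_1 eq_diff_iff)
next
  case (KF i j)
  then show ?case
    using d_rels_intros(3)[of "i - d" M "j - d" z l]
    by (cases "i < d"; cases "j < d") (simp_all add: falg_lift_hom scal_1 eq_diff_iff)
next
  case (EE i j)
  then show ?case
    using d_rels_intros(4)[of "i - d" M "j - d" z l]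
    by (cases "i < d"; cases "j < d") (simp_all add: falg_lift_hom)
next
  case (FF i j)
  then show ?case
    using d_rels_intros(5)[of "i - d" M "j - d" z l]
    by (cases "i < d"; cases "j < d") (simp_all add: falg_lift_hom)
next
  case (K i)
  then show ?case
    using d_rels_intros(6)[of "i - d" M "i - d" l z]
    by (cases "i < d") (simp_all add: falg_lift_hom zero_power)
next
  case (E i)
  then show ?case
    using d_rels_intros(7)[of "i - d" M "i - d" l z] l
    by (cases "i < d") (simp_all add: falg_lift_hom zero_power)
next
  case (F i)
  then show ?case
    using d_rels_intros(8)[of "i - d" M "i - d" l z] l
    by (cases "i < d") (simp_all add: falg_lift_hom zero_power)
next
  case (EF i j)
  then show ?case
    using d_rels_intros(9)[of "i - d" M "j - d" z l]
    by (cases "i < d"; cases "j < d") (simp_all add: falg_lift_hom eq_diff_iff)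
next
  case (EF_same j)
  then show ?case
    using d_rels_intros(10)[of "j - d" M "j - d" z l] l
    by (cases "j < d")
       (simp_all add: falg_lift_hom lower_hom_ef_sum_low lower_hom_ef_sum_high)
qed


section \<open>The projections\<close>

lemma d_alg_projection:
  assumes l: "l > 1" and "M \<le> N"
  shows "\<exists>\<pi>\<in>alg_surj_hom (d_alg z l N) (d_alg z l M). \<forall>i\<le>N.
           (N - M \<le> i \<longrightarrow> \<pi> (dE z l N i) = dE z l M (i - (N - M)) \<and>
              \<pi> (dF z l N i) = dF z l M (i - (N - M)) \<and>
              \<pi> (dK z l N i) = dK z l M (i - (N - M))) \<and>
           (i < N - M \<longrightarrow> \<pi> (dE z l N i) = \<zero>\<^bsub>d_alg z l M\<^esub> \<and>
              \<pi> (dF z l N i) = \<zero>\<^bsub>d_alg z l M\<^esub> \<and> \<pi> (dK z l N i) = \<one>\<^bsub>d_alg z l M\<^esub>)"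
proof -
  define d where "d = N - M"
  have N: "N = M + d" using assms by (simp add: d_def)
  have "\<exists>\<pi>\<in>alg_surj_hom (d_alg z l N) (d_alg z l M). \<forall>p\<in>carrier (free_algebra (d_gens N)).
          \<pi> (presented_cls (d_gens N) (d_rels z l N) p) =
            presented_cls (d_gens M) (d_rels z l M) (lower_hom d p)"
    unfolding d_alg_def
  proof (rule presented_surj_hom[OF d_rels_closed d_rels_closed])
    fix g assume "g \<in> d_gens N"
    then show "lower d g \<in> carrier (free_algebra (d_gens M))"
      by (cases g) (auto simp: N)
  next
    fix g assume g: "g \<in> d_gens M"
    have "gen g = lower d (case g of DE i \<Rightarrow> DE (i + d) | DF i \<Rightarrow> DF (i + d) | DK i \<Rightarrow> DK (i + d))"
      by (cases g) auto
    moreover have "(case g of DE i \<Rightarrow> DE (i + d) | DF i \<Rightarrow> DF (i + d) | DK i \<Rightarrow> DK (i + d)) \<in> d_gens N"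
      using g by (cases g) (auto simp: N)
    ultimately show "gen g \<in> lower d ` d_gens N" by (rule image_eqI)
  next
    fix r assume "r \<in> d_rels z l N"
    then show "lower_hom d r \<in> insert 0 (d_rels z l M)"
      unfolding N by (rule lower_hom_d_rels[OF l])
  qed
  then show ?thesis
    by (rule bexE, intro bexI)
       (auto simp: dE_def dF_def dK_def d_def d_alg_def presented_cls_zero[OF d_rels_closed]
          presented_cls_one)
qed

text \<open>
  The renaming of the letters at level 0 as those of the small quantum group. The index is ignored,
  as only the letters of index 0 are used.
\<close>

fun d0_to_u :: "d_gen \<Rightarrow> u_gen falg" where
  "d0_to_u (DE i) = gen UE"
| "d0_to_u (DF i) = gen UF"
| "d0_to_u (DK i) = gen UK"

lemma qint_1:
  assumes "z - inverse z \<noteq> 0"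
  shows "qint z 1 = 1"
  using assms by (simp add: qint_def power_int_minus)

text \<open>
  The two summands of the relation at level 0 are \<open>F E\<close> and \<open>[K; 0; 1]\<close>. Since division by 0
  yields 0, the hypothesis on \<open>z\<close> is what makes \<open>[1]! = 1\<close>, the denominator in \<open>E^(1)\<close> and
  \<open>F^(1)\<close>.
\<close>

lemma d0_to_u_ef_sum:
  assumes l: "l > 1" and z: "z - inverse z \<noteq> 0"
  shows "falg_lift d0_to_u (ef_sum z l 0 0) =
           gen UF * gen UE + scal (1 / (z - inverse z)) * (gen UK - gen UK ^ (l - 1))"
proof -
  have digit: "digit l 0 0 = 0" "digit l 1 0 = 1"
    using l by (simp_all add: digit_def)
  have "qfact z 1 = 1" using qint_1[OF z] by (simp add: qfact_def)
  then show ?thesis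
    by (simp add: ef_sum_def dE_div_def dF_div_def dK_bin_def digit falg_lift_hom falg_lift_qbin
        scal_1)
       (simp add: qbin_def scal_1 power_int_minus)
qed

lemma u_rels_closed: "u_rels z l \<subseteq> carrier (free_algebra UNIV)"
  by (auto simp: u_rels_def)

lemma d0_to_u_rels:
  assumes l: "l > 1" and z: "z - inverse z \<noteq> 0" and "r \<in> d_rels z l 0"
  shows "falg_lift d0_to_u r \<in> insert 0 (u_rels z l)"
  using assms(3)
proof (induction rule: d_rels_induct)
  case (EF_same j)
  then have "falg_lift d0_to_u (gen (DE j) * gen (DF j) - ef_sum z l 0 j) = gen UE * gen UF - gen UF * gen UE
         - scal (1 / (z - inverse z)) * (gen UK - gen UK ^ (l - 1))"
    by (simp add: falg_lift_diff falg_lift_mult d0_to_u_ef_sum[OF l z] diff_diff_eq)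
  then show ?case by (simp add: u_rels_def)
qed (auto simp: falg_lift_hom u_rels_def)

lemma d_alg_0_to_u_alg:
  assumes l: "l > 1" and z: "z - inverse z \<noteq> 0"
  shows "\<exists>\<pi>\<in>alg_surj_hom (d_alg z l 0) (u_alg z l).
           \<pi> (dE z l 0 0) = uE z l \<and> \<pi> (dF z l 0 0) = uF z l \<and> \<pi> (dK z l 0 0) = uK z l"
proof -
  have "\<exists>\<pi>\<in>alg_surj_hom (d_alg z l 0) (u_alg z l). \<forall>p\<in>carrier (free_algebra (d_gens 0)).
          \<pi> (presented_cls (d_gens 0) (d_rels z l 0) p) =
            presented_cls UNIV (u_rels z l) (falg_lift d0_to_u p)"
    unfolding d_alg_def u_alg_def
  proof (rule presented_surj_hom[OF d_rels_closed u_rels_closed])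
    fix g :: u_gen
    show "gen g \<in> d0_to_u ` d_gens 0"
      by (cases g) (auto simp: d_gens_def)
  next
    fix g
    show "d0_to_u g \<in> carrier (free_algebra UNIV)" by (cases g) auto
  qed (rule d0_to_u_rels[OF l z])
  then show ?thesis
    by (rule bexE, intro bexI) (auto simp: dE_def dF_def dK_def uE_def uF_def uK_def)
qed

lemma primitive_root_minus_inverse_nonzero:
  assumes "odd l" "l > 1" "primitive_root_of_unity l z"
  shows "z - inverse z \<noteq> 0"
proof
  assume "z - inverse z = 0"
  moreover have "z \<noteq> 0" using assms by (auto simp: primitive_root_of_unity_def zero_power)
  ultimately have "z ^ 2 = 1" by (simp add: power2_eq_square field_simps)
  moreover have "2 < l" using assms by (cases "l = 2") auto
  ultimately show False using assms(3) by (auto simp: primitive_root_of_unity_def)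
qed

lemma d_alg_to_u_alg:
  assumes l: "l > 1" and z: "z - inverse z \<noteq> 0"
  shows "\<exists>\<pi>\<in>alg_surj_hom (d_alg z l N) (u_alg z l). \<forall>i\<le>N.
           \<pi> (dE z l N i) = (if i = N then uE z l else \<zero>\<^bsub>u_alg z l\<^esub>) \<and>
           \<pi> (dF z l N i) = (if i = N then uF z l else \<zero>\<^bsub>u_alg z l\<^esub>) \<and>
           \<pi> (dK z l N i) = (if i = N then uK z l else \<one>\<^bsub>u_alg z l\<^esub>)"
proof -
  obtain f where f: "f \<in> alg_surj_hom (d_alg z l N) (d_alg z l 0)"
    and f_gen: "\<forall>i\<le>N.
      (N - 0 \<le> i \<longrightarrow> f (dE z l N i) = dE z l 0 (i - (N - 0)) \<and>
         f (dF z l N i) = dF z l 0 (i - (N - 0)) \<and> f (dK z l N i) = dK z l 0 (i - (N - 0))) \<and>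
      (i < N - 0 \<longrightarrow> f (dE z l N i) = \<zero>\<^bsub>d_alg z l 0\<^esub> \<and>
         f (dF z l N i) = \<zero>\<^bsub>d_alg z l 0\<^esub> \<and> f (dK z l N i) = \<one>\<^bsub>d_alg z l 0\<^esub>)"
    using d_alg_projection[OF l, of 0 N z] by blast
  have f_top: "f (dE z l N N) = dE z l 0 0" "f (dF z l N N) = dF z l 0 0"
      "f (dK z l N N) = dK z l 0 0"
    using f_gen by simp_all
  have f_low: "f (dE z l N i) = \<zero>\<^bsub>d_alg z l 0\<^esub>" "f (dF z l N i) = \<zero>\<^bsub>d_alg z l 0\<^esub>"
      "f (dK z l N i) = \<one>\<^bsub>d_alg z l 0\<^esub>" if "i < N" for i
    using f_gen that by simp_all
  obtain g where g: "g \<in> alg_surj_hom (d_alg z l 0) (u_alg z l)"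
    and g_gen: "g (dE z l 0 0) = uE z l" "g (dF z l 0 0) = uF z l" "g (dK z l 0 0) = uK z l"
    using d_alg_0_to_u_alg[OF assms] by blast
  interpret g: ring_hom_ring "d_alg z l 0" "u_alg z l" g
    using g complex_algebra_d_alg complex_algebra_u_alg
    by (intro ring_hom_ringI2 ring_complex_algebra) (auto simp: alg_surj_hom_def alg_hom_def)
  show ?thesis
    by (intro bexI[OF _ alg_surj_hom_compose[OF f g]]) (auto simp: f_top f_low g_gen)
qed

theorem lemma3p4:
  fixes l :: nat and lam :: complex
  assumes "odd l" and "l > 1" and "primitive_root_of_unity l lam"
  shows "(\<forall>M N :: nat. M < N \<longrightarrow>
            (\<exists>\<pi> \<in> alg_surj_hom (d_alg lam l N) (d_alg lam l M).
               \<forall>i\<le>N.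
                 (N - M \<le> i \<longrightarrow>
                    \<pi> (dE lam l N i) = dE lam l M (i - (N - M)) \<and>
                    \<pi> (dF lam l N i) = dF lam l M (i - (N - M)) \<and>
                    \<pi> (dK lam l N i) = dK lam l M (i - (N - M))) \<and>
                 (i < N - M \<longrightarrow>
                    \<pi> (dE lam l N i) = \<zero>\<^bsub>d_alg lam l M\<^esub> \<and>
                    \<pi> (dF lam l N i) = \<zero>\<^bsub>d_alg lam l M\<^esub> \<and>
                    \<pi> (dK lam l N i) = \<one>\<^bsub>d_alg lam l M\<^esub>))) \<and>
         (\<forall>N :: nat. \<exists>\<pi> \<in> alg_surj_hom (d_alg lam l N) (u_alg lam l).
            \<forall>i\<le>N.
              \<pi> (dE lam l N i) = (if i = N then uE lam l else \<zero>\<^bsub>u_alg lam l\<^esub>) \<and>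
              \<pi> (dF lam l N i) = (if i = N then uF lam l else \<zero>\<^bsub>u_alg lam l\<^esub>) \<and>
              \<pi> (dK lam l N i) = (if i = N then uK lam l else \<one>\<^bsub>u_alg lam l\<^esub>))"
proof (intro conjI allI impI)
  fix M N :: nat
  assume "M < N"
  then show "\<exists>\<pi>\<in>alg_surj_hom (d_alg lam l N) (d_alg lam l M). \<forall>i\<le>N.
      (N - M \<le> i \<longrightarrow>
         \<pi> (dE lam l N i) = dE lam l M (i - (N - M)) \<and>
         \<pi> (dF lam l N i) = dF lam l M (i - (N - M)) \<and>
         \<pi> (dK lam l N i) = dK lam l M (i - (N - M))) \<and>
      (i < N - M \<longrightarrow>
         \<pi> (dE lam l N i) = \<zero>\<^bsub>d_alg lam l M\<^esub> \<and>
         \<pi> (dF lam l N i) = \<zero>\<^bsub>d_alg lam l M\<^esub> \<and>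
         \<pi> (dK lam l N i) = \<one>\<^bsub>d_alg lam l M\<^esub>)"
    by (intro d_alg_projection assms(2)) simp
qed (rule d_alg_to_u_alg[OF assms(2) primitive_root_minus_inverse_nonzero[OF assms]])

end
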